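(* For every admissible index $\mathbf{k}$, \[ T(\mathbf{k})=\sum_{m=0}^{|\mathbf{k}|} A(\mathbf{k}^{(m)};i)\,\overline{A\big((\mathbf{k}^{*})^{(|\mathbf{k}|-m)};i\big)}, \] where the bar denotes complex conjugation.
   Context: An index $\mathbf{k}=(k_1,\dots,k_n)\in\mathbb{Z}_{\ge1}^n$ is admissible if $k_n\ge2$; $\emptyset$ is admissible. Weight $|\mathbf{k}|=k_1+\dots+k_n$. Multiple $T$-values: for admissible $\mathbf{k}$, $T(\mathbf{k})=2^n\sum_{0<m_1<\cdots<m_n,\ m_j\equiv j \bmod 2} m_1^{-k_1}\cdots m_n^{-k_n}$, $T(\emptyset)=1$. Multiple $A$-functions: for $\mathbf{k}\in\mathbb{Z}_{\ge1}^n$, $A(\mathbf{k};z)=2^n\sum_{0<m_1<\cdots<m_n,\ m_j\equiv j\bmod 2} z^{m_n}/(m_1^{k_1}\cdots m_n^{k_n})$ for $|z|<1$, continued holomorphically to $\mathbb{C}\setminus((-\infty,-1]\cup[1,\infty))$; $A(\emptyset;z)=1$. Dual index: writing an admissible $\mathbf{k}=(\{1\}^{a_1-1},b_1+1,\dots,\{1\}^{a_h-1},b_h+1)$ (where $\{1\}^m$ denotes $m$ repetitions of $1$), $\mathbf{k}^*=(\{1\}^{b_h-1},a_h+1,\dots,\{1\}^{b_1-1},a_1+1)$. Truncations: $\mathbf{k}^{(0)}=\mathbf{k}$; $\mathbf{k}^{(1)}=(k_1,\dots,k_{n-1},k_n-1)$ if $k_n>1$, $\mathbf{k}^{(1)}=(k_1,\dots,k_{n-1})$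 if $k_n=1$ and $n\ge2$, $\mathbf{k}^{(1)}=\emptyset$ if $n=1,k_1=1$; and $\mathbf{k}^{(m)}=(\mathbf{k}^{(m-1)})^{(1)}$ for $m>1$. *)

theory Defs
  imports "HOL-Complex_Analysis.Complex_Analysis"
begin

text \<open>Indices are lists of positive integers; list position \<open>j\<close> (from 0) holds $k_{j+1}$.\<close>

definition is_index :: "nat list \<Rightarrow> bool" where
  "is_index ks \<longleftrightarrow> (\<forall>k\<in>set ks. k \<ge> 1)"

definition admissible :: "nat list \<Rightarrow> bool" where
  "admissible ks \<longleftrightarrow> is_index ks \<and> (ks \<noteq> [] \<longrightarrow> last ks \<ge> 2)"

abbreviation weight :: "nat list \<Rightarrow> nat" where
  "weight \<equiv> sum_list"

text \<open>The tuples $0 < m_1 < \dots < m_n$ with $m_j \equiv j$ modulo 2;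
  the index shift from 0-based positions appears as \<open>Suc j\<close>.\<close>

definition alt_tuples :: "nat \<Rightarrow> nat list set" where
  "alt_tuples n = {ms. length ms = n \<and> (\<forall>m\<in>set ms. 0 < m) \<and> sorted_wrt (<) ms \<and>
                       (\<forall>j<n. ms ! j mod 2 = Suc j mod 2)}"

definition T_value :: "nat list \<Rightarrow> real" where
  "T_value ks = 2 ^ length ks *
     (\<Sum>\<^sub>\<infinity>ms\<in>alt_tuples (length ks). 1 / (\<Prod>j<length ks. real (ms ! j) ^ (ks ! j)))"

definition A_series :: "nat list \<Rightarrow> complex \<Rightarrow> complex" where
  "A_series ks z =
     (if ks = [] then 1
      else 2 ^ length ks *
        (\<Sum>\<^sub>\<infinity>ms\<in>alt_tuples (length ks).
           z ^ last ms / (\<Prod>j<length ks. of_nat (ms ! j) ^ (ks ! j))))"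

definition slit_plane :: "complex set" where
  "slit_plane = UNIV - of_real ` ({..-1} \<union> {1..})"

text \<open>The holomorphic continuation of the series from the open unit disc. As the slit plane is
  connected, the continuation is unique there; values outside the slit plane are arbitrary.\<close>

definition A_fun :: "nat list \<Rightarrow> complex \<Rightarrow> complex" where
  "A_fun ks = (SOME f. f holomorphic_on slit_plane \<and> (\<forall>z\<in>ball 0 1. f z = A_series ks z))"

text \<open>\<open>index_of_blocks [(a\<^sub>1,b\<^sub>1),\<dots>,(a\<^sub>h,b\<^sub>h)]\<close> is
  $(\{1\}^{a_1-1},b_1+1,\dots,\{1\}^{a_h-1},b_h+1)$.\<close>

definition index_of_blocks :: "(nat \<times> nat) list \<Rightarrow> nat list" where
  "index_of_blocks ps = concat (map (\<lambda>(a, b). replicate (a - 1) 1 @ [b + 1]) ps)"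

definition blocks_of :: "nat list \<Rightarrow> (nat \<times> nat) list" where
  "blocks_of ks = (THE ps. (\<forall>(a, b)\<in>set ps. a \<ge> 1 \<and> b \<ge> 1) \<and> index_of_blocks ps = ks)"

definition dual_index :: "nat list \<Rightarrow> nat list" where
  "dual_index ks = index_of_blocks (rev (map prod.swap (blocks_of ks)))"

text \<open>The value at the empty index is a convention: \<open>truncate_index m ks\<close> is only meant for
  \<open>m \<le> weight ks\<close>.\<close>

definition truncate1 :: "nat list \<Rightarrow> nat list" where
  "truncate1 ks =
     (if ks = [] then []
      else if last ks > 1 then butlast ks @ [last ks - 1]
      else butlast ks)"

definition truncate_index :: "nat \<Rightarrow> nat list \<Rightarrow> nat list" where
  "truncate_index m ks = (truncate1 ^^ m) ks"


lemma index_of_blocks_Nil [simp]: "index_of_blocks [] = []"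
  by (simp add: index_of_blocks_def)

lemma index_of_blocks_Cons [simp]:
  "index_of_blocks ((a, b) # ps) = replicate (a - 1) 1 @ (b + 1) # index_of_blocks ps"
  by (simp add: index_of_blocks_def)

lemma replicate_one_append_eqD:
  fixes b c :: nat
  assumes "replicate m 1 @ (b + 1) # xs = replicate n 1 @ (c + 1) # ys" "b \<ge> 1" "c \<ge> 1"
  shows "m = n \<and> b = c \<and> xs = ys"
  using assms
proof (induction m arbitrary: n)
  case 0
  then show ?case by (cases n) simp_all
next
  case (Suc m)
  then show ?case by (cases n) simp_all
qed

lemma index_of_blocks_inject:
  assumes "\<forall>(a, b)\<in>set ps. a \<ge> 1 \<and> b \<ge> 1" "\<forall>(a, b)\<in>set qs. a \<ge> 1 \<and> b \<ge> 1"
    and "index_of_blocks ps = index_of_blocks qs"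
  shows "ps = qs"
  using assms
proof (induction ps arbitrary: qs)
  case Nil
  then show ?case by (cases qs) auto
next
  case (Cons p ps)
  obtain a b where p: "p = (a, b)" by force
  with Cons.prems(3) obtain q qs' where qs: "qs = q # qs'" by (cases qs) auto
  obtain c d where q: "q = (c, d)" by force
  from Cons.prems have "a - 1 = c - 1 \<and> b = d \<and> index_of_blocks ps = index_of_blocks qs'"
    unfolding p qs q by (intro replicate_one_append_eqD) auto
  moreover from Cons.prems have "a = c" if "a - 1 = c - 1"
    using that unfolding p qs q by auto
  moreover have "ps = qs'" if "index_of_blocks ps = index_of_blocks qs'"
    using that Cons.prems unfolding p qs q by (intro Cons.IH) simp_all
  ultimately show ?case unfolding p qs q by simp
qed

lemma index_of_blocks_exists:
  assumes "admissible ks"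
  shows "\<exists>ps. (\<forall>(a, b)\<in>set ps. a \<ge> 1 \<and> b \<ge> 1) \<and> index_of_blocks ps = ks"
  using assms
proof (induction ks)
  case Nil
  show ?case by (intro exI[of _ "[]"]) auto
next
  case (Cons k ks)
  have "admissible ks"
    using Cons.prems by (auto simp: admissible_def is_index_def split: if_splits)
  then obtain ps where ps: "\<forall>(a, b)\<in>set ps. a \<ge> 1 \<and> b \<ge> 1" "index_of_blocks ps = ks"
    using Cons.IH by blast
  show ?case
  proof (cases "k = 1")
    case True
    with Cons.prems have "ks \<noteq> []" by (auto simp: admissible_def)
    with ps obtain a b ps' where eq: "ps = (a, b) # ps'" by (cases ps) auto
    with ps(1) obtain a' where a: "a = Suc a'" by (cases a) auto
    show ?thesis using ps True unfolding eq a
      by (intro exI[of _ "(Suc (Suc a'), b) # ps'"]) simp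
  next
    case False
    with Cons.prems have "k \<ge> 2" by (auto simp: admissible_def is_index_def)
    with ps show ?thesis by (intro exI[of _ "(1, k - 1) # ps"]) auto
  qed
qed

lemma blocks_of_eqI:
  assumes "\<forall>(a, b)\<in>set ps. a \<ge> 1 \<and> b \<ge> 1" "index_of_blocks ps = ks"
  shows "blocks_of ks = ps"
  unfolding blocks_of_def
proof (rule the_equality)
  show "(\<forall>(a, b)\<in>set ps. a \<ge> 1 \<and> b \<ge> 1) \<and> index_of_blocks ps = ks"
    using assms by blast
next
  fix qs
  assume "(\<forall>(a, b)\<in>set qs. a \<ge> 1 \<and> b \<ge> 1) \<and> index_of_blocks qs = ks"
  with assms show "qs = ps" by (metis index_of_blocks_inject)
qed

end

theory Submission imports Defs "HOL-Real_Asymp.Real_Asymp" begin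

text \<open>
  On the slit plane, $A(\mathbf{k};z)$ has derivative $\omega(z) A(\mathbf{k}^{(1)};z)$ with
  $\omega = 1/z$ or $\omega = 2/(1-z^2)$, according to whether the last entry of $\mathbf{k}$
  exceeds 1; so $\mathbf{k}$ is encoded by a word in two letters, and truncation removes the last
  letter. Duality reverses the word and swaps the letters, while $\varphi(z) = (1-z)/(1+z)$ swaps
  the two forms up to sign. Hence the derivative of
  $F(z) = \sum_m A(\mathbf{k}^{(m)};z) A((\mathbf{k}^*)^{(|\mathbf{k}|-m)};\varphi(z))$ telescopes
  to 0. Since $\varphi(i) = \overline{i}$, the right-hand side of the theorem is $F(i)$. As $z \to 1$
  along the reals, the terms with $m \ge 1$ vanish, because $A(\mathbf{k}^{(m)};z)$ grows at most like
  a power of the logarithm of $1/(1-z)$, and the term with $m = 0$ tends to $T(\mathbf{k})$.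
\<close>

section \<open>Power series coefficients\<close>

lemma alt_tuples_0 [simp]: "alt_tuples 0 = {[]}"
  by (auto simp: alt_tuples_def)

text \<open>The term \<open>last (0 # ms)\<close> makes the empty tuple end in 0, so that lengths 0 and \<open>Suc n\<close>
  need no separate treatment.\<close>

lemma last_mod2_alt_tuples:
  assumes "ms \<in> alt_tuples n"
  shows "last (0 # ms) mod 2 = n mod 2"
proof (cases ms rule: rev_cases)
  case Nil
  with assms show ?thesis by (auto simp: alt_tuples_def)
next
  case (snoc xs x)
  with assms have n: "n = Suc (length xs)" and "\<forall>j<n. (xs @ [x]) ! j mod 2 = Suc j mod 2"
    by (auto simp: alt_tuples_def)
  from this(2)[rule_format, of "length xs"] n snoc show ?thesis by simp
qed

text \<open>The last entry of a tuple of length \<open>n\<close> has the parity of \<open>n\<close>,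
  so the congruence on the new entry says that its gap to the previous one is odd. In this form the
  condition no longer involves the length.\<close>

lemma snoc_in_alt_tuples_iff:
  "ms @ [N] \<in> alt_tuples (Suc n) \<longleftrightarrow>
     ms \<in> alt_tuples n \<and> last (0 # ms) < N \<and> odd (N - last (0 # ms))"
proof -
  have below: "(\<forall>m\<in>set ms. m < N) \<and> 0 < N \<longleftrightarrow> last (0 # ms) < N" if "sorted_wrt (<) ms"
    using that by (cases ms rule: rev_cases) (auto simp: sorted_wrt_append)
  have parity: "odd (N - last (0 # ms)) \<longleftrightarrow> N mod 2 = Suc n mod 2"
    if "ms \<in> alt_tuples n" "last (0 # ms) < N"
  proof -
    from last_mod2_alt_tuples[OF that(1)] have "even (last (0 # ms)) \<longleftrightarrow> even n"
      by (simp only: even_iff_mod_2_eq_zero)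
    moreover have "N mod 2 = Suc n mod 2 \<longleftrightarrow> (even N \<longleftrightarrow> odd n)" by presburger
    ultimately show ?thesis using that(2) by auto
  qed
  have "ms @ [N] \<in> alt_tuples (Suc n) \<longleftrightarrow>
     ms \<in> alt_tuples n \<and> last (0 # ms) < N \<and> N mod 2 = Suc n mod 2"
  proof (cases "length ms = n \<and> sorted_wrt (<) ms")
    case True
    with below show ?thesis
      by (auto simp: alt_tuples_def sorted_wrt_append nth_append less_Suc_eq)
  next
    case False
    then show ?thesis by (auto simp: alt_tuples_def sorted_wrt_append)
  qed
  with parity show ?thesis by blast
qed

text \<open>Groups the tuples by the exponent of z that they contribute. Each group is finite, so
  the coefficients of the power series are finite sums.\<close>

definition alt_tuples_with_last :: "nat \<Rightarrow> nat \<Rightarrow> nat list set" where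
  "alt_tuples_with_last n N = {ms \<in> alt_tuples n. last (0 # ms) = N}"

lemma alt_tuples_with_last_0: "alt_tuples_with_last 0 N = (if N = 0 then {[]} else {})"
  by (auto simp: alt_tuples_with_last_def)

lemma alt_tuples_with_last_Suc:
  "alt_tuples_with_last (Suc n) N =
     (\<Union>M\<in>{M. M < N \<and> odd (N - M)}. (\<lambda>ms. ms @ [N]) ` alt_tuples_with_last n M)"
proof (intro set_eqI iffI)
  fix ms assume ms: "ms \<in> alt_tuples_with_last (Suc n) N"
  then have "ms \<noteq> []" by (auto simp: alt_tuples_with_last_def alt_tuples_def)
  with ms obtain xs where "ms = xs @ [N]"
    by (cases ms rule: rev_cases) (auto simp: alt_tuples_with_last_def)
  with ms show "ms \<in> (\<Union>M\<in>{M. M < N \<and> odd (N - M)}.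
      (\<lambda>ms. ms @ [N]) ` alt_tuples_with_last n M)"
    by (auto simp: alt_tuples_with_last_def snoc_in_alt_tuples_iff simp del: last.simps)
qed (auto simp: alt_tuples_with_last_def snoc_in_alt_tuples_iff simp del: last.simps; simp)

lemma finite_alt_tuples_with_last [simp]: "finite (alt_tuples_with_last n N)"
  by (induction n arbitrary: N) (simp_all add: alt_tuples_with_last_0 alt_tuples_with_last_Suc)

section \<open>Coefficients: recurrences and bounds\<close>

definition tuple_term :: "nat list \<Rightarrow> nat list \<Rightarrow> real" where
  "tuple_term ks ms = 2 ^ length ks / (\<Prod>j<length ks. real (ms ! j) ^ (ks ! j))"

definition A_coeff :: "nat list \<Rightarrow> nat \<Rightarrow> real" where
  "A_coeff ks N = (\<Sum>ms\<in>alt_tuples_with_last (length ks) N. tuple_term ks ms)"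

lemma tuple_term_nonneg: "tuple_term ks ms \<ge> 0"
  by (simp add: tuple_term_def prod_nonneg)

lemma A_coeff_nonneg: "A_coeff ks N \<ge> 0"
  by (simp add: A_coeff_def sum_nonneg tuple_term_nonneg)

lemma A_coeff_Nil: "A_coeff [] N = (if N = 0 then 1 else 0)"
  by (simp add: A_coeff_def alt_tuples_with_last_0 tuple_term_def)

text \<open>Splitting off the largest entry \<open>N\<close> takes the factor 2 / N^k out of every
  term. Both differential equations for A rest on this recurrence.\<close>

lemma A_coeff_snoc:
  "A_coeff (ks @ [k]) N = 2 / real N ^ k * (\<Sum>M | M < N \<and> odd (N - M). A_coeff ks M)"
proof -
  have "A_coeff (ks @ [k]) N = (\<Sum>M | M < N \<and> odd (N - M).
      \<Sum>ms\<in>(\<lambda>ms. ms @ [N]) ` alt_tuples_with_last (length ks) M. tuple_term (ks @ [k]) ms)"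
    unfolding A_coeff_def length_append_singleton alt_tuples_with_last_Suc
    by (rule sum.UNION_disjoint)
      (simp_all, auto simp: alt_tuples_with_last_def)
  also have "\<dots> = (\<Sum>M | M < N \<and> odd (N - M).
      \<Sum>ms\<in>alt_tuples_with_last (length ks) M. 2 / real N ^ k * tuple_term ks ms)"
  proof (rule sum.cong[OF refl])
    fix M
    have "tuple_term (ks @ [k]) (ms @ [N]) = 2 / real N ^ k * tuple_term ks ms"
      if "length ms = length ks" for ms
    proof -
      have "(\<Prod>j<length ks. real ((ms @ [N]) ! j) ^ ((ks @ [k]) ! j)) =
            (\<Prod>j<length ks. real (ms ! j) ^ (ks ! j))"
        by (rule prod.cong) (simp_all add: nth_append that)
      then show ?thesis by (simp add: tuple_term_def nth_append that)
    qed
    then show "(\<Sum>ms\<in>(\<lambda>ms. ms @ [N]) ` alt_tuples_with_last (length ks) M.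
        tuple_term (ks @ [k]) ms) =
      (\<Sum>ms\<in>alt_tuples_with_last (length ks) M. 2 / real N ^ k * tuple_term ks ms)"
      by (subst sum.reindex)
        (auto simp: inj_on_def alt_tuples_with_last_def alt_tuples_def intro!: sum.cong)
  qed
  also have "\<dots> = 2 / real N ^ k * (\<Sum>M | M < N \<and> odd (N - M). A_coeff ks M)"
    by (simp add: A_coeff_def sum_distrib_left)
  finally show ?thesis .
qed

lemma A_coeff_snoc_0 [simp]: "A_coeff (ks @ [k]) 0 = 0"
  by (simp add: A_coeff_snoc)

text \<open>Coefficient form of the differential equation with the form 1/z.\<close>

lemma A_coeff_snoc_Suc:
  "real N * A_coeff (ks @ [Suc k]) N = A_coeff (ks @ [k]) N"
  by (cases "N = 0") (simp_all add: A_coeff_snoc)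

text \<open>Coefficient form of the equation with 2/(1-z^2): the possible predecessors of N+1 are N
  and the predecessors of N-1, so the two sums differ by a single coefficient.\<close>

lemma A_coeff_snoc_one_step:
  "real (Suc N) * A_coeff (ks @ [1]) (Suc N) =
     (if N = 0 then 0 else real (N - 1) * A_coeff (ks @ [1]) (N - 1)) + 2 * A_coeff ks N"
proof -
  have eq: "real N * A_coeff (ks @ [1]) N = 2 * (\<Sum>M | M < N \<and> odd (N - M). A_coeff ks M)" for N
    by (cases "N = 0") (simp_all add: A_coeff_snoc)
  show ?thesis
  proof (cases N)
    case 0
    have "{M. M < Suc 0 \<and> odd (Suc 0 - M)} = {0}" by auto
    with 0 eq[of "Suc N"] show ?thesis by simp
  next
    case (Suc n)
    have "{M. M < Suc N \<and> odd (Suc N - M)} = insert N {M. M < n \<and> odd (n - M)}"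
    proof -
      have "odd (Suc (Suc n) - M) \<longleftrightarrow> odd (n - M)" if "M < n" for M
        using that by (simp add: Suc_diff_le)
      moreover have "\<not> odd (Suc (Suc n) - n)" by simp
      ultimately show ?thesis using Suc by (auto simp: less_Suc_eq)
    qed
    moreover have "N \<notin> {M. M < n \<and> odd (n - M)}" using Suc by simp
    ultimately show ?thesis using Suc eq[of "Suc N"] eq[of n] by simp
  qed
qed

lemma is_index_snoc: "is_index (ks @ [k]) \<longleftrightarrow> is_index ks \<and> k \<ge> 1"
  by (auto simp: is_index_def)

text \<open>An entry \<open>N\<close> has at most \<open>N\<close> predecessors, and the factor
  1/N^k with k at least 1 absorbs this count. A bound uniform in \<open>N\<close> gives convergence
  in the unit disc.\<close>

lemma A_coeff_le:
  assumes "is_index ks"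
  shows "A_coeff ks N \<le> 2 ^ length ks"
  using assms
proof (induction ks arbitrary: N rule: rev_induct)
  case Nil
  show ?case by (simp add: A_coeff_Nil)
next
  case (snoc k ks)
  then have ks: "is_index ks" and "k \<ge> 1" by (simp_all add: is_index_snoc)
  show ?case
  proof (cases "N = 0")
    case False
    have "(\<Sum>M | M < N \<and> odd (N - M). A_coeff ks M) \<le> (\<Sum>M<N. 2 ^ length ks)"
      using snoc.IH[OF ks] A_coeff_nonneg
      by (intro order.trans[OF sum_mono sum_mono2]) auto
    also have "\<dots> \<le> real N ^ k * 2 ^ length ks"
      using False \<open>k \<ge> 1\<close> self_le_power[of "real N" k] by simp
    finally show ?thesis using False by (simp add: A_coeff_snoc field_simps)
  qed simp
qed

text \<open>Lowering all exponents to 1 only enlarges the terms. Growth near 1 is thereby reduced to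
  indices of ones, whose series are powers of a logarithm up to a factorial.\<close>

lemma A_coeff_le_ones:
  assumes "is_index ks"
  shows "A_coeff ks N \<le> A_coeff (replicate (length ks) 1) N"
  using assms
proof (induction ks arbitrary: N rule: rev_induct)
  case (snoc k ks)
  then have ks: "is_index ks" and "k \<ge> 1" by (simp_all add: is_index_snoc)
  have "A_coeff (ks @ [k]) N \<le> A_coeff (replicate (length ks) 1 @ [1]) N"
  proof (cases "N = 0")
    case False
    then show ?thesis unfolding A_coeff_snoc
      using \<open>k \<ge> 1\<close> snoc.IH[OF ks] A_coeff_nonneg self_le_power[of "real N" k]
      by (intro mult_mono divide_left_mono sum_mono sum_nonneg) auto
  qed simp
  then show ?case by (simp add: replicate_append_same)
qed simp

lemma summable_A_coeff:
  assumes "is_index ks" and "norm (z :: 'a :: {real_normed_field, banach}) < 1"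
  shows "summable (\<lambda>N. norm (of_real (A_coeff ks N) * z ^ N))"
proof (rule summable_comparison_test')
  show "summable (\<lambda>N. 2 ^ length ks * norm z ^ N)"
    using assms(2) by (intro summable_mult summable_geometric) simp
  show "norm (norm (of_real (A_coeff ks N) * z ^ N)) \<le> 2 ^ length ks * norm z ^ N" for N
    using A_coeff_le[OF assms(1), of N] A_coeff_nonneg[of ks N]
    by (auto simp: norm_mult norm_power intro!: mult_right_mono)
qed

text \<open>The sum over tuples is regrouped by last entry, which absolute convergence permits. The
  general field serves complex \<open>z\<close> for A and real \<open>z\<close> for T.\<close>

lemma has_sum_tuple_term:
  fixes z :: "'a :: {real_normed_field, banach}"
  assumes "is_index ks" and "norm z < 1"
  shows "((\<lambda>ms. of_real (tuple_term ks ms) * z ^ last (0 # ms)) has_sum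
          (\<Sum>N. of_real (A_coeff ks N) * z ^ N)) (alt_tuples (length ks))"
proof -
  define f where "f = (\<lambda>(N :: nat, ms). of_real (tuple_term ks ms) * z ^ N)"
  define B where "B = alt_tuples_with_last (length ks)"
  \<comment> \<open>\<open>h\<close> will be the identity for the norms and \<open>of_real\<close>
    for the terms themselves.\<close>
  have inner: "((\<lambda>ms. h (tuple_term ks ms) * y ^ N) has_sum (\<Sum>ms\<in>B N. h (tuple_term ks ms) * y ^ N)) (B N)"
    for N :: nat and y :: "'b :: {real_normed_field, banach}" and h
    by (rule has_sum_finite) (simp add: B_def)
  have coeff: "(\<Sum>ms\<in>B N. of_real (tuple_term ks ms) * y ^ N) = of_real (A_coeff ks N) * y ^ N"
    for N :: nat and y :: "'b :: {real_normed_field, banach}"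
    by (simp add: B_def A_coeff_def sum_distrib_right)
  have "(\<lambda>p. norm (f p)) summable_on Sigma UNIV B"
  proof (rule summable_on_SigmaI)
    show "((\<lambda>ms. norm (f (N, ms))) has_sum (A_coeff ks N * norm z ^ N)) (B N)" for N
      using inner[of "\<lambda>x. x" "norm z" N] coeff[of "norm z" N]
      by (simp add: f_def norm_mult norm_power tuple_term_nonneg)
    have "summable (\<lambda>N. norm (of_real (A_coeff ks N) * z ^ N))"
      by (rule summable_A_coeff) fact+
    then show "(\<lambda>N. A_coeff ks N * norm z ^ N) summable_on UNIV"
      by (intro norm_summable_imp_summable_on) (simp add: norm_mult norm_power A_coeff_nonneg)
  qed simp
  then have "f summable_on Sigma UNIV B"
    by (rule abs_summable_summable)
  then have "(f has_sum (\<Sum>N. of_real (A_coeff ks N) * z ^ N)) (Sigma UNIV B)"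
  proof (rule has_sum_SigmaI[rotated 2])
    show "((\<lambda>ms. f (N, ms)) has_sum (of_real (A_coeff ks N) * z ^ N)) (B N)" for N
      using inner[of of_real z N] coeff[of z N] by (simp add: f_def)
    show "((\<lambda>N. of_real (A_coeff ks N) * z ^ N) has_sum (\<Sum>N. of_real (A_coeff ks N) * z ^ N)) UNIV"
      using summable_A_coeff[OF assms]
      by (intro norm_summable_imp_has_sum summable_sums) (auto intro: summable_norm_cancel)
  qed
  moreover have "bij_betw (\<lambda>ms. (last (0 # ms), ms)) (alt_tuples (length ks)) (Sigma UNIV B)"
    by (rule bij_betwI[where g = snd]) (auto simp: B_def alt_tuples_with_last_def)
  ultimately have "((\<lambda>ms. f (last (0 # ms), ms)) has_sum (\<Sum>N. of_real (A_coeff ks N) * z ^ N))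
      (alt_tuples (length ks))"
    by (subst has_sum_reindex_bij_betw[where f = f and g = "\<lambda>ms. (last (0 # ms), ms)"])
  then show ?thesis by (simp only: f_def prod.case)
qed

lemma A_series_eq_suminf:
  assumes "is_index ks" and "norm z < 1"
  shows "A_series ks z = (\<Sum>N. of_real (A_coeff ks N) * z ^ N)"
proof -
  have "A_series ks z = (\<Sum>\<^sub>\<infinity>ms\<in>alt_tuples (length ks). of_real (tuple_term ks ms) * z ^ last (0 # ms))"
  proof (cases "ks = []")
    case False
    have "ms \<noteq> []" if "ms \<in> alt_tuples (length ks)" for ms
      using that False by (auto simp: alt_tuples_def)
    with False show ?thesis
      by (auto simp: A_series_def tuple_term_def mult_ac simp flip: infsum_cmult_right'
        intro!: infsum_cong)
  qed (simp add: A_series_def tuple_term_def)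
  also have "\<dots> = (\<Sum>N. of_real (A_coeff ks N) * z ^ N)"
    by (rule infsumI, rule has_sum_tuple_term) fact+
  finally show ?thesis .
qed

lemma T_value_eq_infsum: "T_value ks = (\<Sum>\<^sub>\<infinity>ms\<in>alt_tuples (length ks). tuple_term ks ms)"
  by (simp add: T_value_def tuple_term_def flip: infsum_cmult_right')

section \<open>Formal power series and their differential equations\<close>

definition A_fps :: "nat list \<Rightarrow> complex fps" where
  "A_fps ks = Abs_fps (\<lambda>N. of_real (A_coeff ks N))"

lemma A_fps_nth [simp]: "fps_nth (A_fps ks) N = of_real (A_coeff ks N)"
  by (simp add: A_fps_def)

lemma A_fps_Nil: "A_fps [] = 1"
  by (auto simp: fps_eq_iff A_coeff_Nil)

lemma A_fps_deriv_snoc_Suc: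
  "fps_X * fps_deriv (A_fps (ks @ [Suc k])) = A_fps (ks @ [k])"
proof (rule fps_ext)
  fix N
  show "fps_nth (fps_X * fps_deriv (A_fps (ks @ [Suc k]))) N = fps_nth (A_fps (ks @ [k])) N"
    using A_coeff_snoc_Suc[of N ks k, THEN arg_cong[of _ _ complex_of_real]]
    by (cases N) simp_all
qed

lemma A_fps_deriv_snoc_one:
  "(1 - fps_X ^ 2) * fps_deriv (A_fps (ks @ [1])) = 2 * A_fps ks"
proof (rule fps_ext)
  fix N
  have "fps_nth ((1 - fps_X ^ 2) * fps_deriv (A_fps (ks @ [1]))) N =
        of_nat (Suc N) * of_real (A_coeff (ks @ [1]) (Suc N)) -
        (if N = 0 then 0 else of_nat (N - 1) * of_real (A_coeff (ks @ [1]) (N - 1)))"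
    by (cases N) (auto simp: algebra_simps power2_eq_square split: nat.splits)
  also have "\<dots> = of_real (real (Suc N) * A_coeff (ks @ [1]) (Suc N) -
        (if N = 0 then 0 else real (N - 1) * A_coeff (ks @ [1]) (N - 1)))"
    by simp
  also have "\<dots> = fps_nth (2 * A_fps ks) N"
    unfolding A_coeff_snoc_one_step by (simp add: numeral_fps_const)
  finally show "fps_nth ((1 - fps_X ^ 2) * fps_deriv (A_fps (ks @ [1]))) N = fps_nth (2 * A_fps ks) N" .
qed

lemma fps_conv_radius_A_fps:
  assumes "is_index ks"
  shows "fps_conv_radius (A_fps ks) \<ge> 1"
  unfolding fps_conv_radius_def
proof (rule conv_radius_geI_ex')
  fix r :: real assume "0 < r" "ereal r < 1"
  with summable_A_coeff[OF assms, of "complex_of_real r"]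
  show "summable (\<lambda>n. fps_nth (A_fps ks) n * of_real r ^ n)"
    by (intro summable_norm_cancel[of "\<lambda>n. fps_nth (A_fps ks) n * of_real r ^ n"]) simp
qed

lemma A_series_eq_eval_fps:
  assumes "is_index ks" and "norm z < 1"
  shows "A_series ks z = eval_fps (A_fps ks) z"
  using assms by (simp add: A_series_eq_suminf eval_fps_def)

text \<open>Formal version of the rule that iterating one form n times gives the n-th power of its
  integral over n!. By induction both sides have the same derivative after multiplication by 1 -
  X^2, and both have constant term 0.\<close>

lemma A_fps_ones_power: "fact n * A_fps (replicate n 1) = A_fps [1] ^ n"
proof (induction n)
  case 0
  show ?case by (simp add: A_fps_Nil)
next
  case (Suc n)
  have one: "(1 - fps_X ^ 2) * fps_deriv (A_fps [1]) = 2"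
    using A_fps_deriv_snoc_one[of "[]"] by (simp add: A_fps_Nil)
  have snoc: "replicate (Suc n) 1 = replicate n 1 @ [1 :: nat]"
    by (simp add: replicate_append_same)
  have "fps_deriv (fact (Suc n) :: complex fps) = 0"
    by (metis fps_deriv_of_nat of_nat_fact)
  then have "(1 - fps_X ^ 2) * fps_deriv (fact (Suc n) * A_fps (replicate (Suc n) 1)) =
        fact (Suc n) * ((1 - fps_X ^ 2) * fps_deriv (A_fps (replicate (Suc n) 1)))"
    by (simp add: algebra_simps del: fact_Suc)
  also have "\<dots> = of_nat (Suc n) * 2 * (fact n * A_fps (replicate n 1))"
    unfolding snoc A_fps_deriv_snoc_one by (simp add: algebra_simps)
  also have "\<dots> = of_nat (Suc n) * ((1 - fps_X ^ 2) * fps_deriv (A_fps [1])) * A_fps [1] ^ n"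
    unfolding Suc.IH one ..
  also have "\<dots> = (1 - fps_X ^ 2) * fps_deriv (A_fps [1] ^ Suc n)"
    unfolding fps_deriv_power fps_of_nat[symmetric] diff_Suc_1
    by (simp only: mult_ac)
  finally have "fps_deriv (fact (Suc n) * A_fps (replicate (Suc n) 1)) = fps_deriv (A_fps [1] ^ Suc n)"
    \<comment> \<open>The factor 1 - X^2 is nonzero because its product with the derivative in
      \<open>one\<close> is 2.\<close>
    by (subst (asm) mult_cancel_left) (metis one mult_zero_left zero_neq_numeral)
  moreover have "fps_nth (A_fps (replicate (Suc n) 1)) 0 = 0" "fps_nth (A_fps [1]) 0 = 0"
    unfolding snoc using A_coeff_snoc_0[of "[]" 1] by simp_all
  ultimately show ?case
    by (subst (asm) fps_deriv_eq_iff) (simp del: fact_Suc)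
qed

section \<open>Analytic continuation\<close>

lemma in_slit_plane_iff: "z \<in> slit_plane \<longleftrightarrow> Im z \<noteq> 0 \<or> \<bar>Re z\<bar> < 1"
proof -
  have "z \<in> of_real ` ({..-1} \<union> {1..}) \<longleftrightarrow> Im z = 0 \<and> \<bar>Re z\<bar> \<ge> 1"
  proof
    assume "Im z = 0 \<and> \<bar>Re z\<bar> \<ge> 1"
    then show "z \<in> of_real ` ({..-1} \<union> {1..})"
      by (intro image_eqI[of _ _ "Re z"]) (auto simp: complex_eq_iff)
  qed auto
  then show ?thesis by (auto simp: slit_plane_def)
qed

lemma open_slit_plane: "open slit_plane"
proof -
  have "slit_plane = {z. Im z \<noteq> 0} \<union> {z. \<bar>Re z\<bar> < 1}"
    by (auto simp: in_slit_plane_iff)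
  moreover have "open {z. Im z \<noteq> 0}" "open {z. \<bar>Re z\<bar> < 1}"
    by (intro open_Collect_neq open_Collect_less continuous_intros)+
  ultimately show ?thesis using open_Un by metis
qed

text \<open>Being starlike about 0 yields primitives of holomorphic functions as well as
  connectedness.\<close>

lemma starlike_slit_plane: "starlike slit_plane"
  unfolding starlike_def
proof (intro bexI ballI subsetI)
  show "0 \<in> slit_plane" by (simp add: in_slit_plane_iff)
  fix z w assume "z \<in> slit_plane" "w \<in> closed_segment 0 z"
  then obtain u where u: "0 \<le> u" "u \<le> 1" and w: "w = of_real u * z"
    by (auto simp: in_segment scaleR_conv_of_real)
  have "\<bar>u * Re z\<bar> < 1" if "\<bar>Re z\<bar> < 1"
    using mult_left_le_one_le[of "\<bar>Re z\<bar>" u] u that by (simp add: abs_mult)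
  with \<open>z \<in> slit_plane\<close> show "w \<in> slit_plane"
    by (auto simp: in_slit_plane_iff w)
qed

lemma connected_slit_plane: "connected slit_plane"
  by (simp add: starlike_imp_connected starlike_slit_plane)

lemma ball_subset_slit_plane: "ball 0 1 \<subseteq> slit_plane"
proof
  fix z :: complex assume "z \<in> ball 0 1"
  with abs_Re_le_cmod[of z] show "z \<in> slit_plane" by (auto simp: in_slit_plane_iff)
qed

lemma slit_plane_square_neq_1: "z \<in> slit_plane \<Longrightarrow> z\<^sup>2 \<noteq> 1"
  by (auto simp: power2_eq_1_iff in_slit_plane_iff)

text \<open>The identity theorem in the form used below: equations for A are checked on the disc by
  power series and then carried over to the slit plane.\<close>

lemma slit_plane_eqI:
  assumes "f holomorphic_on slit_plane" "g holomorphic_on slit_plane"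
    and "\<And>z. norm z < 1 \<Longrightarrow> f z = g z" and "z \<in> slit_plane"
  shows "f z = g z"
  by (rule analytic_continuation_open[of "ball 0 1" slit_plane f g])
    (use assms in \<open>auto simp: open_slit_plane connected_slit_plane ball_subset_slit_plane\<close>)

section \<open>The differential equations in the unit disc\<close>

lemma eval_fps_A_fps_deriv:
  assumes "is_index ks" "norm z < 1"
  shows "(eval_fps (A_fps ks) has_field_derivative eval_fps (fps_deriv (A_fps ks)) z) (at z)"
proof (rule has_field_derivative_eval_fps)
  from assms(2) have "ereal (norm z) < 1" by simp
  also note fps_conv_radius_A_fps[OF assms(1)]
  finally show "ereal (norm z) < fps_conv_radius (A_fps ks)" .
qed

lemma norm_less_conv_radius_A_fps_deriv:
  assumes "is_index ks" "norm z < 1"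
  shows "ereal (norm z) < fps_conv_radius (fps_deriv (A_fps ks))"
proof -
  from assms(2) have "ereal (norm z) < 1" by simp
  also note fps_conv_radius_A_fps[OF assms(1)]
  also note fps_conv_radius_deriv
  finally show ?thesis .
qed

lemma eval_fps_A_fps_deriv_snoc_Suc:
  assumes "is_index (ks @ [Suc k])" "norm z < 1"
  shows "z * eval_fps (fps_deriv (A_fps (ks @ [Suc k]))) z = eval_fps (A_fps (ks @ [k])) z"
  by (subst A_fps_deriv_snoc_Suc[symmetric], subst eval_fps_mult)
    (use norm_less_conv_radius_A_fps_deriv[OF assms] in auto)

lemma eval_fps_A_fps_deriv_snoc_one:
  assumes "is_index ks" "norm z < 1"
  shows "(1 - z ^ 2) * eval_fps (fps_deriv (A_fps (ks @ [1]))) z = 2 * eval_fps (A_fps ks) z"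
proof -
  have ind: "is_index (ks @ [1])" using assms(1) by (simp add: is_index_snoc)
  have "eval_fps (1 - fps_X ^ 2 :: complex fps) z = 1 - z ^ 2"
    by (subst eval_fps_diff) auto
  moreover have "fps_conv_radius (1 - fps_X ^ 2 :: complex fps) = \<infinity>"
    using fps_conv_radius_diff[of 1 "fps_X ^ 2 :: complex fps"] by simp
  ultimately have "(1 - z ^ 2) * eval_fps (fps_deriv (A_fps (ks @ [1]))) z =
      eval_fps ((1 - fps_X ^ 2) * fps_deriv (A_fps (ks @ [1]))) z"
    using norm_less_conv_radius_A_fps_deriv[OF ind assms(2)] by (subst eval_fps_mult) auto
  also have "\<dots> = 2 * eval_fps (A_fps ks) z"
  proof -
    from assms(2) have "ereal (norm z) < 1" by simp
    also note fps_conv_radius_A_fps[OF assms(1)]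
    finally show ?thesis unfolding A_fps_deriv_snoc_one by (subst eval_fps_mult) auto
  qed
  finally show ?thesis .
qed

text \<open>It suffices to continue the derivative: a primitive of \<open>h\<close> exists on the
  starlike domain and differs from the series on the disc by a constant, which is
  subtracted.\<close>

lemma slit_plane_primitive:
  assumes "is_index ks" and h: "h holomorphic_on slit_plane"
    and eq: "\<And>z. norm z < 1 \<Longrightarrow> h z = eval_fps (fps_deriv (A_fps ks)) z"
  shows "\<exists>f. f holomorphic_on slit_plane \<and> (\<forall>z\<in>ball 0 1. f z = A_series ks z)"
proof -
  have "\<exists>f. \<forall>z\<in>slit_plane. (f has_field_derivative h z) (at z)"
    using holomorphic_on_imp_continuous_on[OF h] starlike_slit_plane open_slit_plane finite.emptyI
  proof (rule holomorphic_starlike_primitive)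
    show "h field_differentiable at z" if "z \<in> slit_plane - {}" for z
      using holomorphic_on_imp_differentiable_at[OF h open_slit_plane] that by simp
  qed
  then obtain f where "\<forall>z\<in>slit_plane. (f has_field_derivative h z) (at z)" ..
  then have f: "(f has_field_derivative h z) (at z)" if "z \<in> slit_plane" for z
    using that by simp
  have "((\<lambda>z. f z - eval_fps (A_fps ks) z) has_field_derivative 0) (at z within ball 0 1)"
    if "z \<in> ball 0 1" for z
  proof -
    from that have "norm z < 1" by simp
    moreover from that have "z \<in> slit_plane" using ball_subset_slit_plane by blast
    ultimately have "((\<lambda>z. f z - eval_fps (A_fps ks) z) has_field_derivative
        h z - eval_fps (fps_deriv (A_fps ks)) z) (at z)"
      by (intro DERIV_diff f eval_fps_A_fps_deriv assms(1))
    then show ?thesis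
      using eq[OF \<open>norm z < 1\<close>] by (simp add: has_field_derivative_at_within)
  qed
  then obtain c where "\<forall>z\<in>ball 0 1. f z - eval_fps (A_fps ks) z = c"
    using has_field_derivative_zero_constant[OF convex_ball] by blast
  then have "\<forall>z\<in>ball 0 1. f z - c = A_series ks z"
    using A_series_eq_eval_fps[OF assms(1)] by (auto simp: algebra_simps)
  moreover have "(\<lambda>z. f z - c) holomorphic_on slit_plane"
    unfolding holomorphic_on_open[OF open_slit_plane]
    using DERIV_diff[OF f DERIV_const] by blast
  ultimately show ?thesis by blast
qed

text \<open>Induction on the weight: the derivative is the continued function of the truncated index
  times 2/(1-z^2) or 1/z. The first factor is holomorphic on the slit plane; the second leaves a
  removable singularity at 0.\<close>

lemma A_series_continuation_exists:
  assumes "is_index ks"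
  shows "\<exists>f. f holomorphic_on slit_plane \<and> (\<forall>z\<in>ball 0 1. f z = A_series ks z)"
  using assms
proof (induction "sum_list ks" arbitrary: ks rule: less_induct)
  case less
  show ?case
  proof (cases ks rule: rev_cases)
    case Nil
    then show ?thesis by (intro exI[of _ "\<lambda>_. 1"]) (auto simp: A_series_def)
  next
    case (snoc js l)
    with less.prems have js: "is_index js" and "l \<ge> 1" by (auto simp: is_index_snoc)
    from \<open>l \<ge> 1\<close> obtain k where l: "l = Suc k" by (cases l) auto
    show ?thesis
    proof (cases "k = 0")
      case True
      with less.hyps[of js] js snoc l obtain G where G: "G holomorphic_on slit_plane"
        "\<forall>z\<in>ball 0 1. G z = A_series js z" by auto
      show ?thesis
      proof (rule slit_plane_primitive[OF less.prems])
        show "(\<lambda>z. 2 * G z / (1 - z\<^sup>2)) holomorphic_on slit_plane"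
          using slit_plane_square_neq_1 by (intro holomorphic_intros G) auto
        show "2 * G z / (1 - z\<^sup>2) = eval_fps (fps_deriv (A_fps ks)) z" if "norm z < 1" for z
        proof -
          have "z\<^sup>2 \<noteq> 1"
            using slit_plane_square_neq_1[of z] ball_subset_slit_plane that by auto
          moreover have "G z = eval_fps (A_fps js) z"
            using G(2) A_series_eq_eval_fps[OF js that] that by simp
          ultimately show ?thesis
            using eval_fps_A_fps_deriv_snoc_one[OF js that] snoc l True
            by (simp add: nonzero_divide_eq_eq mult.commute)
        qed
      qed
    next
      case False
      then have jsk: "is_index (js @ [k])" using js by (simp add: is_index_snoc)
      with less.hyps[of "js @ [k]"] snoc l obtain G where G: "G holomorphic_on slit_plane"
        "\<forall>z\<in>ball 0 1. G z = A_series (js @ [k]) z" by auto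
      define g where "g = eval_fps (fps_deriv (A_fps ks))"
      \<comment> \<open>In particular G(0) = 0 and G'(0) = g(0), which is the value needed at the
        removable singularity.\<close>
      have Gg: "G z = z * g z" if "norm z < 1" for z
        using eval_fps_A_fps_deriv_snoc_Suc[of js k z] less.prems snoc l that G
          A_series_eq_eval_fps[OF jsk that] by (simp add: g_def)
      obtain g' where "(g has_field_derivative g') (at 0)"
        using has_field_derivative_eval_fps[OF norm_less_conv_radius_A_fps_deriv[OF less.prems]]
        by (metis g_def norm_zero zero_less_one)
      then have "((\<lambda>z. z * g z) has_field_derivative g 0) (at 0)"
        by (auto intro!: derivative_eq_intros)
      then have "(G has_field_derivative g 0) (at 0)"
        by (rule has_field_derivative_transform_within_open[of _ _ _ "ball 0 1"]) (auto simp: Gg)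
      then have G': "deriv G 0 = g 0" by (rule DERIV_imp_deriv)
      show ?thesis
      proof (rule slit_plane_primitive[OF less.prems])
        \<comment> \<open>As G(0) = 0, this difference quotient is G(z)/z with the singularity
          filled in.\<close>
        show "(\<lambda>z. if z = 0 then deriv G 0 else (G z - G 0) / (z - 0)) holomorphic_on slit_plane"
          by (rule pole_lemma_open) (auto simp: G open_slit_plane)
        show "(if z = 0 then deriv G 0 else (G z - G 0) / (z - 0)) =
            eval_fps (fps_deriv (A_fps ks)) z" if "norm z < 1" for z
          using Gg[OF that] Gg[of 0] G' by (simp add: g_def)
      qed
    qed
  qed
qed

section \<open>Functional equations of the continued functions\<close>

lemma
  assumes "is_index ks"
  shows holomorphic_A_fun: "A_fun ks holomorphic_on slit_plane"
    and A_fun_eq_A_series: "norm z < 1 \<Longrightarrow> A_fun ks z = A_series ks z"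
  using someI_ex[OF A_series_continuation_exists[OF assms]]
  unfolding A_fun_def[symmetric] by auto

lemma A_fun_eq_eval_fps:
  assumes "is_index ks" "norm z < 1"
  shows "A_fun ks z = eval_fps (A_fps ks) z"
  using A_fun_eq_A_series[OF assms] A_series_eq_eval_fps[OF assms] by simp

lemma A_fun_Nil:
  assumes "z \<in> slit_plane"
  shows "A_fun [] z = 1"
  by (rule slit_plane_eqI[OF _ _ _ assms])
    (auto simp: holomorphic_A_fun A_fun_eq_A_series is_index_def A_series_def)

lemma has_field_derivative_A_fun:
  assumes "is_index ks" "z \<in> slit_plane"
  shows "(A_fun ks has_field_derivative deriv (A_fun ks) z) (at z)"
  using holomorphic_derivI[OF holomorphic_A_fun open_slit_plane] assms by blast

lemma deriv_A_fun_ball: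
  assumes "is_index ks" "norm z < 1"
  shows "deriv (A_fun ks) z = eval_fps (fps_deriv (A_fps ks)) z"
proof (rule DERIV_imp_deriv)
  show "(A_fun ks has_field_derivative eval_fps (fps_deriv (A_fps ks)) z) (at z)"
    using eval_fps_A_fps_deriv[OF assms]
    by (rule has_field_derivative_transform_within_open[of _ _ _ "ball 0 1"])
      (use assms in \<open>auto simp: A_fun_eq_eval_fps\<close>)
qed

text \<open>Multiplied by z, the equation has holomorphic sides on the whole slit plane, 0 included,
  so the identity theorem applies.\<close>

lemma deriv_A_fun_snoc_Suc:
  assumes "is_index (ks @ [k])" "z \<in> slit_plane"
  shows "z * deriv (A_fun (ks @ [Suc k])) z = A_fun (ks @ [k]) z"
proof (rule slit_plane_eqI[OF _ _ _ assms(2)])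
  have ind: "is_index (ks @ [Suc k])" using assms(1) by (simp add: is_index_snoc)
  show "(\<lambda>z. z * deriv (A_fun (ks @ [Suc k])) z) holomorphic_on slit_plane"
    by (intro holomorphic_intros holomorphic_A_fun ind open_slit_plane)
  show "A_fun (ks @ [k]) holomorphic_on slit_plane"
    by (rule holomorphic_A_fun) fact
  show "z * deriv (A_fun (ks @ [Suc k])) z = A_fun (ks @ [k]) z" if "norm z < 1" for z
    using eval_fps_A_fps_deriv_snoc_Suc[OF ind that]
    by (simp add: deriv_A_fun_ball[OF ind that] A_fun_eq_eval_fps[OF assms(1) that])
qed

lemma deriv_A_fun_snoc_one:
  assumes "is_index ks" "z \<in> slit_plane"
  shows "(1 - z\<^sup>2) * deriv (A_fun (ks @ [1])) z = 2 * A_fun ks z"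
proof (rule slit_plane_eqI[OF _ _ _ assms(2)])
  have ind: "is_index (ks @ [1])" using assms(1) by (simp add: is_index_snoc)
  show "(\<lambda>z. (1 - z\<^sup>2) * deriv (A_fun (ks @ [1])) z) holomorphic_on slit_plane"
    by (intro holomorphic_intros holomorphic_A_fun ind open_slit_plane)
  show "(\<lambda>z. 2 * A_fun ks z) holomorphic_on slit_plane"
    by (intro holomorphic_intros holomorphic_A_fun) fact
  show "(1 - z\<^sup>2) * deriv (A_fun (ks @ [1])) z = 2 * A_fun ks z" if "norm z < 1" for z
    using eval_fps_A_fps_deriv_snoc_one[OF assms(1) that]
    by (simp only: deriv_A_fun_ball[OF ind that] A_fun_eq_eval_fps[OF assms(1) that])
qed

text \<open>Schwarz reflection: the Taylor coefficients are real, so conjugating argument and value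
  gives a holomorphic function that agrees with A on the disc.\<close>

lemma A_fun_cnj:
  assumes "is_index ks" "z \<in> slit_plane"
  shows "A_fun ks (cnj z) = cnj (A_fun ks z)"
proof -
  have cnj_slit: "cnj ` slit_plane = slit_plane"
  proof -
    have "w \<in> cnj ` slit_plane \<longleftrightarrow> w \<in> slit_plane" for w
      by (simp add: image_cnj_conv_vimage_cnj in_slit_plane_iff)
    then show ?thesis by blast
  qed
  have "(cnj \<circ> A_fun ks \<circ> cnj) z = A_fun ks z"
  proof (rule slit_plane_eqI[OF _ _ _ assms(2)])
    show "(cnj \<circ> A_fun ks \<circ> cnj) holomorphic_on slit_plane"
      using holomorphic_A_fun[OF assms(1)]
      by (subst holomorphic_on_compose_cnj_cnj) (simp_all add: cnj_slit open_slit_plane)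
    show "A_fun ks holomorphic_on slit_plane" by (rule holomorphic_A_fun) fact
    show "(cnj \<circ> A_fun ks \<circ> cnj) w = A_fun ks w" if "norm w < 1" for w
    proof -
      have "summable (\<lambda>N. of_real (A_coeff ks N) * cnj w ^ N)"
        using summable_A_coeff[OF assms(1), of "cnj w"] that
        by (intro summable_norm_cancel[of "\<lambda>N. of_real (A_coeff ks N) * cnj w ^ N"]) simp
      then have "(\<lambda>N. of_real (A_coeff ks N) * cnj w ^ N) sums A_fun ks (cnj w)"
        using that A_fun_eq_eval_fps[OF assms(1), of "cnj w"]
        by (simp add: eval_fps_def summable_sums)
      then have "(\<lambda>N. of_real (A_coeff ks N) * w ^ N) sums cnj (A_fun ks (cnj w))"
        by (subst (asm) sums_cnj[symmetric]) simp
      then show ?thesis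
        using that A_fun_eq_eval_fps[OF assms(1), of w] by (simp add: eval_fps_def sums_iff)
    qed
  qed
  then show ?thesis by (metis comp_apply complex_cnj_cnj)
qed

section \<open>Behaviour at 1\<close>

text \<open>This says that A(1;z) is a logarithm of (1+z)/(1-z), without choosing a branch. The
  quotient \<open>f\<close> has derivative 0 because (1-z^2) A'(1;z) = 2.\<close>

lemma exp_A_fun_one:
  assumes "norm z < 1"
  shows "exp (A_fun [1] z) * (1 - z) = 1 + z"
proof -
  have ind: "is_index [1]" by (simp add: is_index_def)
  define f where "f = (\<lambda>z. exp (A_fun [1] z) * (1 - z) / (1 + z))"
  have nz: "1 + w \<noteq> 0" if "w \<in> ball 0 1" for w :: complex
    using that by (auto simp: add_eq_0_iff)
  have "(f has_field_derivative 0) (at w within ball 0 1)" if w: "w \<in> ball 0 1" for w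
  proof -
    define a where "a = deriv (A_fun [1]) w"
    have slit: "w \<in> slit_plane" using w ball_subset_slit_plane by blast
    from deriv_A_fun_snoc_one[of "[]", OF _ slit] have "(1 - w\<^sup>2) * a = 2"
      by (simp add: a_def is_index_def A_fun_Nil[OF slit])
    then have eq: "a * (1 - w) * (1 + w) = 2"
      by (simp add: algebra_simps power2_eq_square)
    have "(f has_field_derivative
        ((exp (A_fun [1] w) * a * (1 - w) - exp (A_fun [1] w)) * (1 + w) -
         exp (A_fun [1] w) * (1 - w)) / ((1 + w) * (1 + w))) (at w)"
      unfolding f_def using nz[OF w] has_field_derivative_A_fun[OF ind slit]
      by (auto intro!: derivative_eq_intros simp: a_def)
    also have "(exp (A_fun [1] w) * a * (1 - w) - exp (A_fun [1] w)) * (1 + w) -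
         exp (A_fun [1] w) * (1 - w) = exp (A_fun [1] w) * (a * (1 - w) * (1 + w) - 2)"
      by (simp add: algebra_simps)
    finally show ?thesis by (simp add: eq has_field_derivative_at_within)
  qed
  then obtain c where c: "\<forall>w\<in>ball 0 1. f w = c"
    using has_field_derivative_zero_constant[OF convex_ball] by blast
  have "A_fun [1] 0 = 0"
    using A_fun_eq_eval_fps[OF ind, of 0] A_coeff_snoc_0[of "[]" 1] by (simp add: eval_fps_at_0)
  then have "f 0 = 1" by (simp add: f_def)
  with c assms have "f z = 1" by (metis centre_in_ball mem_ball_0 zero_less_one)
  with nz[of z] assms show ?thesis by (simp add: f_def)
qed

section \<open>Growth on the real interval and the limit at 1\<close>

definition A_real :: "nat list \<Rightarrow> real \<Rightarrow> real" where
  "A_real ks x = (\<Sum>N. A_coeff ks N * x ^ N)"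

lemma summable_A_real:
  assumes "is_index ks" "\<bar>x\<bar> < 1"
  shows "summable (\<lambda>N. A_coeff ks N * x ^ N)"
  using summable_A_coeff[OF assms(1), of x] assms(2)
  by (intro summable_norm_cancel[of "\<lambda>N. A_coeff ks N * x ^ N"]) simp

lemma A_fun_of_real:
  assumes "is_index ks" "\<bar>x\<bar> < 1"
  shows "A_fun ks (of_real x) = of_real (A_real ks x)"
  using A_fun_eq_eval_fps[OF assms(1), of "of_real x"] assms(2) summable_A_real[OF assms]
  by (simp add: eval_fps_def A_real_def suminf_of_real)

lemma A_real_nonneg:
  assumes "is_index ks" "0 \<le> x" "x < 1"
  shows "A_real ks x \<ge> 0"
  unfolding A_real_def
  using assms by (intro suminf_nonneg summable_A_real) (auto simp: A_coeff_nonneg)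

lemma A_real_ones:
  assumes "\<bar>x\<bar> < 1"
  shows "A_real (replicate n 1) x = A_real [1] x ^ n / fact n"
proof -
  have ind: "is_index (replicate n 1)" "is_index [1]"
    by (auto simp: is_index_def)
  have less: "ereal (norm (complex_of_real x)) < fps_conv_radius (A_fps ks)" if "is_index ks" for ks
  proof -
    have "ereal (norm (complex_of_real x)) < 1" using assms by simp
    also note fps_conv_radius_A_fps[OF that]
    finally show ?thesis .
  qed
  have "complex_of_real (fact n * A_real (replicate n 1) x) =
        of_nat (fact n) * eval_fps (A_fps (replicate n 1)) (of_real x)"
    using A_fun_of_real[OF ind(1) assms] A_fun_eq_eval_fps[OF ind(1), of "of_real x"] assms by simp
  also have "\<dots> = eval_fps (fps_const (of_nat (fact n)) * A_fps (replicate n 1)) (of_real x)"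
    using less[OF ind(1)] by (subst eval_fps_mult) auto
  also have "\<dots> = eval_fps (A_fps [1] ^ n) (of_real x)"
    by (metis fps_of_nat of_nat_fact A_fps_ones_power)
  also have "\<dots> = complex_of_real (A_real [1] x ^ n)"
    using less[OF ind(2)] A_fun_of_real[OF ind(2) assms] A_fun_eq_eval_fps[OF ind(2), of "of_real x"] assms
    by (subst eval_fps_power) auto
  finally have "fact n * A_real (replicate n 1) x = A_real [1] x ^ n"
    unfolding of_real_eq_iff .
  then show ?thesis by (simp add: field_simps)
qed

lemma A_real_le:
  assumes "is_index ks" "0 \<le> x" "x < 1"
  shows "A_real ks x \<le> A_real [1] x ^ length ks / fact (length ks)"
proof -
  have "is_index (replicate (length ks) 1)" by (simp add: is_index_def)
  then have "A_real ks x \<le> A_real (replicate (length ks) 1) x"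
    unfolding A_real_def using assms A_coeff_le_ones[OF assms(1)]
    by (intro suminf_le summable_A_real mult_right_mono) auto
  also have "\<dots> = A_real [1] x ^ length ks / fact (length ks)"
    using assms by (intro A_real_ones) simp
  finally show ?thesis .
qed

lemma A_real_one:
  assumes "0 \<le> x" "x < 1"
  shows "A_real [1] x = ln ((1 + x) / (1 - x))"
proof -
  have "complex_of_real (exp (A_real [1] x) * (1 - x)) = of_real (1 + x)"
    using exp_A_fun_one[of "of_real x"] A_fun_of_real[of "[1]" x] assms
    by (simp add: is_index_def exp_of_real)
  then have "exp (A_real [1] x) * (1 - x) = 1 + x" unfolding of_real_eq_iff .
  then have "exp (A_real [1] x) = (1 + x) / (1 - x)" using assms by (simp add: field_simps)
  then show ?thesis by (metis ln_exp)
qed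

text \<open>With l = ln((1+x)/(1-x)) the factor (1-x)/(1+x) is exp(-l), while
  \<open>A_real ks x\<close> is at most l^n/n! for n the length of \<open>ks\<close>. Since l tends
  to infinity, the exponential wins.\<close>

lemma A_real_times_tendsto_0:
  assumes "is_index ks"
  shows "((\<lambda>x. A_real ks x * ((1 - x) / (1 + x))) \<longlongrightarrow> 0) (at_left 1)"
proof (rule tendsto_sandwich)
  define l where "l = (\<lambda>x :: real. ln ((1 + x) / (1 - x)))"
  have ev: "\<forall>\<^sub>F x :: real in at_left 1. 0 < x \<and> x < 1"
    by (rule eventually_at_leftI[of 0]) auto
  then show "\<forall>\<^sub>F x in at_left 1. 0 \<le> A_real ks x * ((1 - x) / (1 + x))"
    by eventually_elim (use A_real_nonneg[OF assms] in auto)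
  show "\<forall>\<^sub>F x in at_left 1. A_real ks x * ((1 - x) / (1 + x)) \<le>
          l x ^ length ks / exp (l x) / fact (length ks)"
    using ev
  proof eventually_elim
    case (elim x)
    then have "A_real ks x * ((1 - x) / (1 + x)) \<le>
        A_real [1] x ^ length ks / fact (length ks) * ((1 - x) / (1 + x))"
      using A_real_le[OF assms, of x] by (intro mult_right_mono) auto
    also have "\<dots> = l x ^ length ks / fact (length ks) * inverse (exp (l x))"
      using A_real_one[of x] elim by (simp add: l_def)
    finally show ?case by (simp add: divide_inverse mult_ac)
  qed
  have "filterlim l at_top (at_left 1)" unfolding l_def by real_asymp
  from filterlim_compose[OF tendsto_power_div_exp_0 this]
  show "((\<lambda>x. l x ^ length ks / exp (l x) / fact (length ks)) \<longlongrightarrow> 0) (at_left 1)"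
    by (rule tendsto_divide_zero)
qed simp

text \<open>Summability of \<open>g\<close> is part of the conclusion: convergence of the series for $T(\mathbf{k})$ is
  obtained from the boundedness of $A(\mathbf{k};x)$ for $x < 1$.\<close>

lemma has_sum_Abel_limit:
  fixes g :: "'a \<Rightarrow> real" and L :: "'a \<Rightarrow> nat"
  assumes nonneg: "\<And>s. s \<in> S \<Longrightarrow> g s \<ge> 0"
    and sums: "\<And>x. 0 < x \<Longrightarrow> x < 1 \<Longrightarrow> ((\<lambda>s. g s * x ^ L s) has_sum f x) S"
    and lim: "(f \<longlongrightarrow> c) (at_left 1)"
  shows "(g has_sum c) S"
proof -
  have ev: "\<forall>\<^sub>F x :: real in at_left 1. 0 < x \<and> x < 1"
    by (rule eventually_at_leftI[of 0]) auto
  \<comment> \<open>For finite \<open>F\<close> the limit x to 1 can be taken termwise, and by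
    nonnegativity \<open>f x\<close> dominates each finite sum.\<close>
  have le: "sum g F \<le> c" if F: "finite F" "F \<subseteq> S" for F
  proof (rule tendsto_le[OF _ lim])
    have "((\<lambda>x :: real. \<Sum>s\<in>F. g s * x ^ L s) \<longlongrightarrow> (\<Sum>s\<in>F. g s * 1 ^ L s)) (at_left 1)"
      by (intro tendsto_intros)
    then show "((\<lambda>x. \<Sum>s\<in>F. g s * x ^ L s) \<longlongrightarrow> sum g F) (at_left 1)" by simp
    show "\<forall>\<^sub>F x in at_left 1. (\<Sum>s\<in>F. g s * x ^ L s) \<le> f x"
      using ev
    proof eventually_elim
      case (elim x)
      show ?case
        by (rule has_sum_mono_neutral[OF has_sum_finite[OF F(1)] sums])
          (use elim F nonneg in auto)
    qed
  qed simp
  then have summable: "g summable_on S"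
    using nonneg by (intro nonneg_bdd_above_summable_on bdd_aboveI[of _ c]) auto
  \<comment> \<open>Conversely the powers of x are at most 1, so every \<open>f x\<close> is bounded
    by the full sum.\<close>
  have "c \<le> infsum g S"
  proof (rule tendsto_upperbound[OF lim])
    show "\<forall>\<^sub>F x in at_left 1. f x \<le> infsum g S"
      using ev
    proof eventually_elim
      case (elim x)
      show ?case
        by (rule has_sum_mono[OF sums has_sum_infsum[OF summable]])
          (use elim nonneg in \<open>auto intro!: mult_left_le power_le_one\<close>)
    qed
  qed simp
  moreover have "infsum g S \<le> c"
    by (rule infsum_le_finite_sums[OF summable]) (use le in auto)
  ultimately show ?thesis using has_sum_infsum[OF summable] by simp
qed

lemma T_value_eqI:
  assumes "is_index ks" and "(A_real ks \<longlongrightarrow> c) (at_left 1)"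
  shows "T_value ks = c"
  unfolding T_value_eq_infsum
proof (rule infsumI, rule has_sum_Abel_limit[OF tuple_term_nonneg _ assms(2)])
  fix x :: real assume "0 < x" "x < 1"
  then show "((\<lambda>ms. tuple_term ks ms * x ^ last (0 # ms)) has_sum A_real ks x)
      (alt_tuples (length ks))"
    using has_sum_tuple_term[OF assms(1), of x] by (simp add: A_real_def del: last.simps)
qed

section \<open>Words and duality\<close>

text \<open>\<open>True\<close> stands for the form 2/(1-z^2) and \<open>False\<close> for 1/z. The
  last letter names the form that appears on differentiating A.\<close>

definition letters :: "nat list \<Rightarrow> bool list" where
  "letters ks = concat (map (\<lambda>k. True # replicate (k - 1) False) ks)"

lemma letters_Nil [simp]: "letters [] = []"
  by (simp add: letters_def)

lemma letters_append [simp]: "letters (ks @ js) = letters ks @ letters js"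
  by (simp add: letters_def)

lemma letters_Cons [simp]: "letters (k # ks) = True # replicate (k - 1) False @ letters ks"
  by (simp add: letters_def)

lemma letters_eq_Nil_iff [simp]: "letters ks = [] \<longleftrightarrow> ks = []"
  by (cases ks) auto

lemma length_letters: "is_index ks \<Longrightarrow> length (letters ks) = sum_list ks"
  by (induction ks) (auto simp: is_index_def)

lemma is_index_truncate1:
  assumes "is_index ks"
  shows "is_index (truncate1 ks)"
  using assms by (cases ks rule: rev_cases) (auto simp: truncate1_def is_index_snoc)

text \<open>Lowering a last entry above 1 deletes its final \<open>False\<close>; dropping a last
  entry 1 deletes its only letter \<open>True\<close>.\<close>

lemma letters_truncate1:
  assumes "is_index ks"
  shows "letters (truncate1 ks) = butlast (letters ks)"
proof (cases ks rule: rev_cases)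
  case (snoc js k)
  show ?thesis
  proof (cases "k > 1")
    case True
    then have "k = Suc (Suc (k - 2))" by simp
    then obtain l where k: "k = Suc (Suc l)" by blast
    then have "letters ks = (letters js @ True # replicate l False) @ [False]"
      by (simp add: snoc replicate_append_same)
    then have "butlast (letters ks) = letters js @ True # replicate l False"
      by (simp only: butlast_snoc)
    then show ?thesis by (simp add: snoc k truncate1_def)
  next
    case False
    with assms snoc have "k = 1" by (auto simp: is_index_def)
    then show ?thesis by (simp add: snoc truncate1_def butlast_append)
  qed
qed (simp add: truncate1_def)

lemma truncate_index_Suc: "truncate_index (Suc m) ks = truncate1 (truncate_index m ks)"
  by (simp add: truncate_index_def)

lemma is_index_truncate_index:
  assumes "is_index ks"
  shows "is_index (truncate_index m ks)"
  by (induction m) (simp_all add: truncate_index_Suc is_index_truncate1 assms truncate_index_def[of 0])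

lemma letters_truncate_index:
  assumes "is_index ks"
  shows "letters (truncate_index m ks) = take (sum_list ks - m) (letters ks)"
proof (induction m)
  case 0
  show ?case by (simp add: truncate_index_def length_letters assms)
next
  case (Suc m)
  then show ?case
    using is_index_truncate_index[OF assms, of m] length_letters[OF assms]
    by (simp add: truncate_index_Suc letters_truncate1 butlast_take)
qed

text \<open>The a-1 ones and the head of the entry b+1 give a letters \<open>True\<close>, and the
  rest of that entry gives b letters \<open>False\<close>. This makes the effect of swapping a and b
  visible.\<close>

lemma letters_index_of_blocks:
  assumes "\<forall>(a, b)\<in>set ps. a \<ge> 1 \<and> b \<ge> 1"
  shows "letters (index_of_blocks ps) =
    concat (map (\<lambda>(a, b). replicate a True @ replicate b False) ps)"
proof -
  have ones: "letters (replicate n 1) = replicate n True" for n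
    by (induction n) simp_all
  show ?thesis
    using assms
  proof (induction ps)
    case (Cons p ps)
    obtain a b where p: "p = (Suc a, b)"
      using Cons.prems by (cases p) (metis (no_types, lifting) Suc_le_D One_nat_def case_prodD list.set_intros(1))
    with Cons show ?case
      using ones[of a] by (simp add: replicate_app_Cons_same)
  qed simp
qed

lemma is_index_index_of_blocks: "is_index (index_of_blocks ps)"
  by (auto simp: index_of_blocks_def is_index_def)

lemma is_index_dual: "is_index (dual_index ks)"
  by (simp add: dual_index_def is_index_index_of_blocks)

text \<open>Reversing and negating the word of a block (a,b) gives b times \<open>True\<close>
  followed by a times \<open>False\<close>, the word of the swapped block.\<close>

lemma letters_dual:
  assumes "admissible ks"
  shows "letters (dual_index ks) = rev (map Not (letters ks))"
proof -
  obtain ps where ps: "\<forall>(a, b)\<in>set ps. a \<ge> 1 \<and> b \<ge> 1" "index_of_blocks ps = ks"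
    using index_of_blocks_exists[OF assms] by blast
  have "letters (dual_index ks) = letters (index_of_blocks (rev (map prod.swap ps)))"
    by (simp add: dual_index_def blocks_of_eqI[OF ps])
  also have "\<dots> = concat (map (\<lambda>(a, b). replicate a True @ replicate b False) (rev (map prod.swap ps)))"
    using ps(1) by (intro letters_index_of_blocks) auto
  also have "\<dots> = rev (map Not (concat (map (\<lambda>(a, b). replicate a True @ replicate b False) ps)))"
    by (induction ps) auto
  also have "\<dots> = rev (map Not (letters ks))"
    using letters_index_of_blocks[OF ps(1)] ps(2) by simp
  finally show ?thesis .
qed

lemma sum_list_dual:
  assumes "admissible ks"
  shows "sum_list (dual_index ks) = sum_list ks"
  using assms length_letters[of ks] length_letters[OF is_index_dual, of ks]
  by (simp add: letters_dual admissible_def)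

definition form :: "bool \<Rightarrow> complex \<Rightarrow> complex" where
  "form b z = (if b then 2 / (1 - z\<^sup>2) else 1 / z)"

lemma deriv_A_fun:
  assumes "is_index ks" "ks \<noteq> []" "z \<in> slit_plane" "z \<noteq> 0"
  shows "deriv (A_fun ks) z = form (last (letters ks)) z * A_fun (truncate1 ks) z"
proof -
  from assms(2) obtain js k where ks: "ks = js @ [k]" by (cases ks rule: rev_cases) auto
  with assms(1) have js: "is_index js" and "k \<ge> 1" by (auto simp: is_index_snoc)
  show ?thesis
  proof (cases "k = 1")
    case True
    with deriv_A_fun_snoc_one[OF js assms(3)] slit_plane_square_neq_1[OF assms(3)]
    show ?thesis by (simp add: ks form_def truncate1_def nonzero_eq_divide_eq mult.commute)
  next
    case False
    with \<open>k \<ge> 1\<close> have "k = Suc (Suc (k - 2))" by simp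
    then obtain l where k: "k = Suc (Suc l)" by blast
    have "is_index (js @ [Suc l])" using js by (simp add: is_index_snoc)
    from deriv_A_fun_snoc_Suc[OF this assms(3)] assms(4)
    show ?thesis by (simp add: ks k form_def truncate1_def nonzero_eq_divide_eq mult.commute)
  qed
qed

section \<open>The telescoping sum\<close>

definition moebius :: "complex \<Rightarrow> complex" where
  "moebius z = (1 - z) / (1 + z)"

text \<open>A convex region containing $i$ and the interval $(0,1)$ that meets the real line nowhere else.\<close>

definition wedge :: "complex set" where
  "wedge = {z. Re z + Im z / 2 < 1 \<and> 0 < Re z + 2 * Im z}"

lemma convex_wedge: "convex wedge"
proof -
  have "wedge = {z. inner (Complex 1 (1/2)) z < 1} \<inter> {z. inner (Complex 1 2) z > 0}"
    by (auto simp: wedge_def inner_complex_def)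
  then show ?thesis by (metis convex_Int convex_halfspace_lt convex_halfspace_gt)
qed

lemma wedge_real: "z \<in> wedge \<Longrightarrow> Im z = 0 \<Longrightarrow> 0 < Re z \<and> Re z < 1"
  by (simp add: wedge_def)

lemma wedge_subset_slit_plane: "wedge \<subseteq> slit_plane"
  using wedge_real by (force simp: in_slit_plane_iff)

lemma wedge_neq: "z \<in> wedge \<Longrightarrow> z \<noteq> 0 \<and> 1 + z \<noteq> 0 \<and> 1 - z \<noteq> 0"
  using wedge_real[of z] by (auto simp: complex_eq_iff)

text \<open>A real value of this map forces \<open>z\<close> to be real, and the real points of the
  wedge lie in (0,1), where the value is again in (0,1).\<close>

lemma moebius_in_slit_plane:
  assumes "z \<in> wedge"
  shows "moebius z \<in> slit_plane"
proof (rule ccontr)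
  assume "moebius z \<notin> slit_plane"
  then have "Im (moebius z) = 0" and ge: "\<bar>Re (moebius z)\<bar> \<ge> 1"
    by (auto simp: in_slit_plane_iff)
  then obtain r where r: "moebius z = of_real r"
    by (metis complex_is_Real_iff Reals_cases)
  then have "1 - z = of_real r * (1 + z)"
    using wedge_neq[OF assms] by (simp add: moebius_def field_simps)
  then have re: "1 - Re z = r * (1 + Re z)" and im: "- Im z = r * Im z"
    by (auto simp: complex_eq_iff)
  have "Im z = 0"
  proof (rule ccontr)
    assume "Im z \<noteq> 0"
    \<comment> \<open>The value -1 is taken only at infinity.\<close>
    with im have "r = -1" by (metis mult_cancel_right mult_minus1)
    with re show False by simp
  qed
  with wedge_real[OF assms] have z: "0 < Re z" "Re z < 1" by auto
  with re have "r = (1 - Re z) / (1 + Re z)" by (simp add: field_simps)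
  with z have "\<bar>r\<bar> < 1" by simp
  with ge r show False by simp
qed

text \<open>The factor -2/(1+z)^2 is the derivative of \<open>moebius\<close>, so this is the
  pullback of the forms: each becomes minus the other.\<close>

lemma form_moebius:
  assumes "z \<in> wedge"
  shows "form b (moebius z) * (-2 / (1 + z)\<^sup>2) = - form (\<not> b) z"
proof -
  note nz = wedge_neq[OF assms]
  have sq: "1 - (moebius z)\<^sup>2 = 4 * z / (1 + z)\<^sup>2"
    using nz by (simp add: moebius_def power_divide divide_simps) (simp add: algebra_simps power2_eq_square)
  have "(1 - z\<^sup>2) = (1 - z) * (1 + z)" by (simp add: algebra_simps power2_eq_square)
  then have "form False (moebius z) * (-2 / (1 + z)\<^sup>2) = - form True z"
    using nz by (simp add: form_def moebius_def divide_simps power2_eq_square)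
  moreover have "form True (moebius z) * (-2 / (1 + z)\<^sup>2) = - form False z"
    using nz by (simp add: form_def sq divide_simps)
  ultimately show ?thesis by (cases b) simp_all
qed

lemma has_field_derivative_moebius:
  "1 + z \<noteq> 0 \<Longrightarrow> (moebius has_field_derivative (-2 / (1 + z)\<^sup>2)) (at z)"
  unfolding moebius_def
  by (auto intro!: derivative_eq_intros simp: field_simps power2_eq_square)

text \<open>After \<open>m\<close> truncations \<open>sum_list ks - m\<close> letters remain, so the
  last one sits at zero-based position \<open>sum_list ks - Suc m\<close>.\<close>

lemma deriv_A_fun_truncate:
  assumes "is_index ks" "m < sum_list ks" "z \<in> slit_plane" "z \<noteq> 0"
  shows "deriv (A_fun (truncate_index m ks)) z =
    form (letters ks ! (sum_list ks - Suc m)) z * A_fun (truncate_index (Suc m) ks) z"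
proof -
  have letters: "letters (truncate_index m ks) = take (sum_list ks - m) (letters ks)"
    by (rule letters_truncate_index) fact
  then have "length (letters (truncate_index m ks)) = sum_list ks - m"
    by (simp add: length_letters[OF assms(1)])
  with assms(2) have ne: "truncate_index m ks \<noteq> []" by auto
  have "last (letters (truncate_index m ks)) = letters ks ! (sum_list ks - Suc m)"
    unfolding letters using length_letters[OF assms(1)] assms(2)
    by (subst last_conv_nth) auto
  with deriv_A_fun[OF is_index_truncate_index[OF assms(1)] ne assms(3,4)]
  show ?thesis by (simp add: truncate_index_Suc)
qed

section \<open>Constancy of the dual sum\<close>

lemma truncate_index_weight:
  assumes "is_index ks"
  shows "truncate_index (sum_list ks) ks = []"
  using letters_truncate_index[OF assms, of "sum_list ks"] by simp

definition dual_sum :: "nat list \<Rightarrow> complex \<Rightarrow> complex" where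
  "dual_sum ks z = (\<Sum>m=0..weight ks. A_fun (truncate_index m ks) z *
     A_fun (truncate_index (weight ks - m) (dual_index ks)) (moebius z))"

text \<open>Differentiating the first factor of a summand raises its truncation by one;
  differentiating the second does the same on the dual side, with opposite sign. Neighbouring
  summands therefore cancel.\<close>

lemma has_field_derivative_dual_sum:
  assumes adm: "admissible ks" and z: "z \<in> wedge"
  shows "(dual_sum ks has_field_derivative 0) (at z)"
proof -
  define w where "w = weight ks"
  define P where "P = (\<lambda>m. A_fun (truncate_index m ks))"
  define Q where "Q = (\<lambda>m. A_fun (truncate_index (w - m) (dual_index ks)))"
  \<comment> \<open>\<open>G m\<close> arises from the first factor of summand m-1 and, negated,
    from the second factor of summand m. It is 0 at m = 0 and m = w+1, where the differentiated
    factor would be the constant A of the empty index.\<close>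
  define G where "G = (\<lambda>m. if 0 < m \<and> m \<le> w
     then form (letters ks ! (w - m)) z * P m z * Q (m - 1) (moebius z) else 0)"
  have ind: "is_index ks" "is_index (dual_index ks)"
    using adm is_index_dual by (auto simp: admissible_def)
  have slit: "z \<in> slit_plane" "moebius z \<in> slit_plane"
    using z wedge_subset_slit_plane moebius_in_slit_plane by auto
  note nz = wedge_neq[OF z]
  have "((\<lambda>z. P m z * Q m (moebius z)) has_field_derivative (G (Suc m) - G m)) (at z)"
    if m: "m \<le> w" for m
  proof -
    have P': "(P m has_field_derivative deriv (P m) z) (at z)"
      unfolding P_def by (intro has_field_derivative_A_fun is_index_truncate_index ind slit)
    have Q': "(Q m has_field_derivative deriv (Q m) (moebius z)) (at (moebius z))"
      unfolding Q_def by (intro has_field_derivative_A_fun is_index_truncate_index ind slit)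
    have "deriv (P m) z * Q m (moebius z) = G (Suc m)"
    proof (cases "m < w")
      case True
      then show ?thesis
        using deriv_A_fun_truncate[OF ind(1) _ slit(1), of m] nz by (simp add: G_def P_def w_def)
    next
      case False
      then have "truncate_index m ks = []"
        using m truncate_index_weight[OF ind(1)] by (simp add: w_def)
      moreover have "deriv (A_fun []) z = 0"
      proof (rule DERIV_imp_deriv)
        show "(A_fun [] has_field_derivative 0) (at z)"
          by (rule has_field_derivative_transform_within_open[OF DERIV_const open_slit_plane slit(1)])
            (simp add: A_fun_Nil)
      qed
      ultimately show ?thesis using False by (simp add: G_def P_def)
    qed
    moreover have "P m z * (deriv (Q m) (moebius z) * (-2 / (1 + z)\<^sup>2)) = - G m"
    proof (cases "m = 0")
      case True
      have "truncate_index w (dual_index ks) = []"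
        using truncate_index_weight[OF ind(2)] sum_list_dual[OF adm] by (simp add: w_def)
      moreover have "deriv (A_fun []) (moebius z) = 0"
      proof (rule DERIV_imp_deriv)
        show "(A_fun [] has_field_derivative 0) (at (moebius z))"
          by (rule has_field_derivative_transform_within_open[OF DERIV_const open_slit_plane slit(2)])
            (simp add: A_fun_Nil)
      qed
      ultimately show ?thesis using True by (simp add: G_def Q_def)
    next
      case False
      have len: "length (letters ks) = w"
        using length_letters[OF ind(1)] by (simp add: w_def)
      \<comment> \<open>The letter that differentiation removes on the dual side is the negation of
        the one in \<open>G m\<close>; the pullback negates it back.\<close>
      have "letters (dual_index ks) ! (m - 1) = (\<not> letters ks ! (w - m))"
        using False m len by (simp add: letters_dual[OF adm] rev_nth)
      moreover have "w - Suc (w - m) = m - 1" "Suc (w - m) = w - (m - 1)"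
        using False m by auto
      moreover have "moebius z \<noteq> 0" using nz by (simp add: moebius_def)
      ultimately have "deriv (Q m) (moebius z) =
          form (\<not> letters ks ! (w - m)) (moebius z) * Q (m - 1) (moebius z)"
        using deriv_A_fun_truncate[OF ind(2) _ slit(2), of "w - m"] False m
        by (simp add: Q_def sum_list_dual[OF adm] w_def)
      then have "P m z * (deriv (Q m) (moebius z) * (-2 / (1 + z)\<^sup>2)) =
          P m z * Q (m - 1) (moebius z) *
            (form (\<not> letters ks ! (w - m)) (moebius z) * (-2 / (1 + z)\<^sup>2))"
        by (simp only: mult_ac)
      also have "\<dots> = - G m"
        unfolding form_moebius[OF z] using False m by (simp add: G_def)
      finally show ?thesis .
    qed
    moreover have "((\<lambda>z. P m z * Q m (moebius z)) has_field_derivative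
        deriv (P m) z * Q m (moebius z) + deriv (Q m) (moebius z) * (-2 / (1 + z)\<^sup>2) * P m z) (at z)"
      using nz by (intro DERIV_mult P' DERIV_chain2[where g = moebius, OF Q'] has_field_derivative_moebius) auto
    ultimately show ?thesis by (simp add: mult_ac)
  qed
  then have "((\<lambda>z. \<Sum>m=0..w. P m z * Q m (moebius z)) has_field_derivative
      (\<Sum>m=0..w. G (Suc m) - G m)) (at z)"
    by (intro DERIV_sum) auto
  also have "(\<Sum>m=0..w. G (Suc m) - G m) = G (Suc w) - G 0"
    by (rule sum_Suc_diff) simp
  also have "\<dots> = 0" by (simp add: G_def)
  finally show ?thesis
    by (simp add: dual_sum_def[abs_def] P_def Q_def w_def)
qed

text \<open>For nonempty \<open>js\<close> the second function vanishes at 0, so its value at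
  \<open>moebius x\<close> is of the order of (1-x)/(1+x), which beats the logarithmic growth of the
  first factor.\<close>

lemma A_fun_times_tendsto_0:
  assumes "is_index ks" "is_index js" "js \<noteq> []"
  shows "((\<lambda>x. A_fun ks (of_real x) * A_fun js (moebius (of_real x))) \<longlongrightarrow> 0) (at_left 1)"
proof -
  define u where "u = (\<lambda>x :: real. (1 - x) / (1 + x))"
  have ev: "\<forall>\<^sub>F x :: real in at_left 1. 0 < x \<and> x < 1"
    by (rule eventually_at_leftI[of 0]) auto
  have u: "u x \<noteq> 0 \<and> moebius (of_real x) = of_real (u x)" if "0 < x \<and> x < 1" for x
    using that by (simp add: u_def moebius_def)
  have js0: "A_fun js 0 = 0"
  proof -
    obtain js' k where "js = js' @ [k]" using assms(3) by (cases js rule: rev_cases) auto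
    then show ?thesis using A_fun_eq_eval_fps[OF assms(2), of 0] by (simp add: eval_fps_at_0)
  qed
  have "((\<lambda>x. complex_of_real (u x)) \<longlongrightarrow> of_real ((1 - 1) / (1 + 1))) (at_left 1)"
    unfolding u_def by (intro tendsto_intros) auto
  moreover have "\<forall>\<^sub>F x in at_left 1. complex_of_real (u x) \<noteq> 0"
    using ev by eventually_elim (use u in auto)
  ultimately have "filterlim (\<lambda>x. complex_of_real (u x)) (at 0) (at_left 1)"
    by (simp add: filterlim_at)
  \<comment> \<open>The difference quotient at 0, by \<open>js0\<close>.\<close>
  moreover have "((\<lambda>h. A_fun js h / h) \<longlongrightarrow> deriv (A_fun js) 0) (at 0)"
    using has_field_derivative_A_fun[OF assms(2), of 0] js0
    by (simp add: DERIV_def in_slit_plane_iff)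
  ultimately have "((\<lambda>x. A_fun js (of_real (u x)) / of_real (u x)) \<longlongrightarrow> deriv (A_fun js) 0) (at_left 1)"
    by (rule filterlim_compose[rotated])
  moreover have "((\<lambda>x. complex_of_real (A_real ks x * u x)) \<longlongrightarrow> of_real 0) (at_left 1)"
    unfolding u_def by (intro tendsto_of_real A_real_times_tendsto_0) fact
  ultimately have "((\<lambda>x. complex_of_real (A_real ks x * u x) *
      (A_fun js (of_real (u x)) / of_real (u x))) \<longlongrightarrow> of_real 0 * deriv (A_fun js) 0) (at_left 1)"
    by (intro tendsto_mult)
  moreover have "\<forall>\<^sub>F x in at_left 1. complex_of_real (A_real ks x * u x) *
      (A_fun js (of_real (u x)) / of_real (u x)) =
      A_fun ks (of_real x) * A_fun js (moebius (of_real x))"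
    using ev by eventually_elim (use u A_fun_of_real[OF assms(1)] in auto)
  ultimately show ?thesis by (simp add: tendsto_cong)
qed

theorem theorem2:
  fixes ks :: "nat list"
  assumes "admissible ks"
  shows "complex_of_real (T_value ks) =
    (\<Sum>m=0..weight ks. A_fun (truncate_index m ks) \<i> *
       cnj (A_fun (truncate_index (weight ks - m) (dual_index ks)) \<i>))"
proof -
  define w where "w = weight ks"
  define C where "C = dual_sum ks \<i>"
  have ind: "is_index ks" "is_index (dual_index ks)"
    using assms is_index_dual by (auto simp: admissible_def)
  have i: "\<i> \<in> wedge" "moebius \<i> = cnj \<i>"
    by (auto simp: wedge_def moebius_def complex_eq_iff Re_divide Im_divide)
  have rhs: "C = (\<Sum>m=0..w. A_fun (truncate_index m ks) \<i> *
       cnj (A_fun (truncate_index (w - m) (dual_index ks)) \<i>))"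
    unfolding C_def dual_sum_def i(2) w_def
    by (intro sum.cong refl arg_cong2[of _ _ _ _ "(*)"] A_fun_cnj is_index_truncate_index ind)
      (simp add: in_slit_plane_iff)
  have ev: "\<forall>\<^sub>F x :: real in at_left 1. 0 < x \<and> x < 1"
    by (rule eventually_at_leftI[of 0]) auto
  have "\<exists>c. \<forall>z\<in>wedge. dual_sum ks z = c"
    by (rule has_field_derivative_zero_constant[OF convex_wedge],
        rule has_field_derivative_at_within[OF has_field_derivative_dual_sum[OF assms]])
  then obtain c where "\<forall>z\<in>wedge. dual_sum ks z = c" ..
  then have const: "dual_sum ks z = C" if "z \<in> wedge" for z
    using that i(1) by (simp add: C_def)
  \<comment> \<open>All summands except m = 0. In that one the dual index is truncated to the empty
    index, so the second factor is 1.\<close>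
  define R where "R = (\<lambda>z. \<Sum>m=Suc 0..w. A_fun (truncate_index m ks) z *
      A_fun (truncate_index (w - m) (dual_index ks)) (moebius z))"
  have "((\<lambda>x :: real. R (of_real x)) \<longlongrightarrow> (\<Sum>m=Suc 0..w. 0)) (at_left 1)"
    unfolding R_def
  proof (intro tendsto_sum A_fun_times_tendsto_0 is_index_truncate_index ind)
    fix m assume m: "m \<in> {Suc 0..w}"
    have len: "length (letters (dual_index ks)) = w"
      using length_letters[OF ind(2)] sum_list_dual[OF assms] by (simp add: w_def)
    \<comment> \<open>Exactly m letters survive, and m is at least 1, so the remaining dual index is
      nonempty.\<close>
    have "length (letters (truncate_index (w - m) (dual_index ks))) = m"
      using m len by (subst letters_truncate_index[OF ind(2)])
        (simp add: sum_list_dual[OF assms] flip: w_def)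
    with m show "truncate_index (w - m) (dual_index ks) \<noteq> []" by auto
  qed
  then have "((\<lambda>x :: real. C - R (of_real x)) \<longlongrightarrow> C - 0) (at_left 1)"
    by (intro tendsto_diff) auto
  moreover have "\<forall>\<^sub>F x :: real in at_left 1. C - R (of_real x) = of_real (A_real ks x)"
    using ev
  proof eventually_elim
    case (elim x)
    then have x: "complex_of_real x \<in> wedge" by (simp add: wedge_def)
    have "truncate_index w (dual_index ks) = []"
      using truncate_index_weight[OF ind(2)] sum_list_dual[OF assms] by (simp add: w_def)
    then have "dual_sum ks (of_real x) = A_fun ks (of_real x) + R (of_real x)"
      using moebius_in_slit_plane[OF x]
      by (simp add: dual_sum_def R_def sum.atLeast_Suc_atMost A_fun_Nil
          truncate_index_def[of 0] flip: w_def)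
    then show ?case using const[OF x] A_fun_of_real[OF ind(1), of x] elim by simp
  qed
  ultimately have lim: "((\<lambda>x. complex_of_real (A_real ks x)) \<longlongrightarrow> C) (at_left 1)"
    by (simp add: tendsto_cong)
  then have "(A_real ks \<longlongrightarrow> Re C) (at_left 1)"
    using tendsto_Re by fastforce
  \<comment> \<open>\<open>C\<close> is a limit of real numbers; uniqueness of the limit shows that
    it equals its real part.\<close>
  then have "T_value ks = Re C" and "((\<lambda>x. complex_of_real (A_real ks x)) \<longlongrightarrow> of_real (Re C)) (at_left 1)"
    using T_value_eqI[OF ind(1)] by (auto intro: tendsto_of_real)
  with lim have "complex_of_real (T_value ks) = C"
    using tendsto_unique[OF trivial_limit_at_left_real] by metis
  with rhs show ?thesis by (simp add: w_def)
qed

end
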